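(* Let $\mathcal{H}$ be a non-trivial complex Hilbert space, let $A\in\mathcal{B}(\mathcal{H})$ be a positive operator, let $T_{11}, T_{12}, T_{21},T_{22} \in \mathcal{B}_A(\mathcal{H})$, and let $B=\begin{pmatrix} A&O\\ O&A\end{pmatrix}$ on $\mathcal{H}\oplus\mathcal{H}$. Then for every real $t$ with $0\leq t\leq 1$, $$w_B\begin{pmatrix} T_{11}&T_{12} \\ T_{21}& T_{22}\end{pmatrix} \leq \frac{1}{2}w_A(T_{22})+w_A(T_{11}) +\frac{1}{2}\sqrt{t^2w^2_A(T_{22})+\|T_{21}\|_A^2} +\frac{1}{2}\sqrt{(1-t)^2w^2_A(T_{22})+\|T_{12}\|_A^2}.$$
   Context: $\mathcal{B}(\mathcal{H})$ is the algebra of bounded linear operators on the complex Hilbert space $(\mathcal{H},\langle\cdot,\cdot\rangle)$; $O$ is the zero operator. $A\in\mathcal{B}(\mathcal{H})$ is positive if $\langle Ax,x\rangle\ge 0$ for all $x\in\mathcal{H}$. Put $\langle x,y\rangle_A=\langle Ax,y\rangle$ and $\|x\|_A=\sqrt{\langle x,x\rangle_A}$ (a semi-norm). $\mathcal{B}_A(\mathcal{H})$ is the set of $T\in\mathcal{B}(\mathcal{H})$ that admit an $A$-adjoint, i.e. some $R\in\mathcal{B}(\mathcal{H})$ with $AR=T^*A$; equivalently $\mathcal{R}(T^*A)\subseteq\mathcal{R}(A)$, where $\mathcal{R}$ denotes range. For such operators, $\|T\|_A=\sup\{\|Tx\|_A/\|x\|_A : x\in\overline{\mathcal{R}(A)},\,x\ne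 0\}$ (finite), $w_A(T)=\sup\{|\langle Tx,x\rangle_A|: x\in\mathcal{H},\|x\|_A=1\}$ ($A$-numerical radius), and $w_A^2(T)=(w_A(T))^2$. The $B$-numerical radius $w_B$ is defined in the same way with $(\mathcal{H},A)$ replaced by $(\mathcal{H}\oplus\mathcal{H},B)$; $B$ is positive on $\mathcal{H}\oplus\mathcal{H}$. *)

theory Defs
  imports "HOL-Analysis.Analysis"
begin

text \<open>
  A complex inner product space is represented as a real inner product space together with a
  complex scalar multiplication and a sesquilinear form whose real part is the given real inner
  product. Hence norm and topology are those of \<^class>\<open>real_inner\<close>. The form is linear
  in its first argument.
\<close>

class complex_inner = real_inner +
  fixes scaleC :: "complex \<Rightarrow> 'a \<Rightarrow> 'a" (infixr "*\<^sub>C" 75)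
    and cinner :: "'a \<Rightarrow> 'a \<Rightarrow> complex"
  assumes scaleC_add_right: "c *\<^sub>C (x + y) = c *\<^sub>C x + c *\<^sub>C y"
    and scaleC_add_left: "(c + d) *\<^sub>C x = c *\<^sub>C x + d *\<^sub>C x"
    and scaleC_scaleC: "c *\<^sub>C d *\<^sub>C x = (c * d) *\<^sub>C x"
    and scaleC_of_real: "complex_of_real r *\<^sub>C x = r *\<^sub>R x"
    and cinner_commute: "cinner x y = cnj (cinner y x)"
    and cinner_add_left: "cinner (x + y) z = cinner x z + cinner y z"
    and cinner_scaleC_left: "cinner (c *\<^sub>C x) y = c * cinner x y"
    and Re_cinner: "Re (cinner x y) = inner x y"

class complex_hilbert = complex_inner + complete_space

instantiation complex :: complex_hilbert
begin

definition scaleC_complex :: "complex \<Rightarrow> complex \<Rightarrow> complex"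
  where "scaleC_complex c x = c * x"

definition cinner_complex :: "complex \<Rightarrow> complex \<Rightarrow> complex"
  where "cinner_complex x y = x * cnj y"

instance
  by standard
    (simp_all add: scaleC_complex_def cinner_complex_def algebra_simps inner_complex_def
      scaleR_conv_of_real)

end

text \<open>The orthogonal direct sum of two spaces is their product type.\<close>

instantiation prod :: (complex_inner, complex_inner) complex_inner
begin

definition scaleC_prod :: "complex \<Rightarrow> 'a \<times> 'b \<Rightarrow> 'a \<times> 'b"
  where "scaleC_prod c x = (c *\<^sub>C fst x, c *\<^sub>C snd x)"

definition cinner_prod :: "'a \<times> 'b \<Rightarrow> 'a \<times> 'b \<Rightarrow> complex"
  where "cinner_prod x y = cinner (fst x) (fst y) + cinner (snd x) (snd y)"

instance
proof
  fix x y :: "'a \<times> 'b"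
  show "cinner x y = cnj (cinner y x)"
    using cinner_commute[of "fst x" "fst y"] cinner_commute[of "snd x" "snd y"]
    by (simp add: cinner_prod_def)
qed (simp_all add: scaleC_prod_def cinner_prod_def scaleC_add_right scaleC_add_left
      scaleC_scaleC scaleC_of_real cinner_add_left cinner_scaleC_left Re_cinner
      inner_prod_def scaleR_prod_def algebra_simps)

end

instance prod :: (complex_hilbert, complex_hilbert) complex_hilbert ..

definition bounded_clinear :: "('a::complex_inner \<Rightarrow> 'b::complex_inner) \<Rightarrow> bool"
  where "bounded_clinear T \<longleftrightarrow> bounded_linear T \<and> (\<forall>c x. T (c *\<^sub>C x) = c *\<^sub>C T x)"

text \<open>
  The adjoint of a bounded operator on a Hilbert space; it exists by the Riesz representation
  theorem and is unique.
\<close>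

definition cadjoint :: "('a::complex_hilbert \<Rightarrow> 'a) \<Rightarrow> 'a \<Rightarrow> 'a"
  where "cadjoint T = (THE S. \<forall>x y. cinner (T x) y = cinner x (S y))"

definition positive_op :: "('a::complex_hilbert \<Rightarrow> 'a) \<Rightarrow> bool"
  where "positive_op A \<longleftrightarrow> bounded_clinear A \<and> (\<forall>x. cinner (A x) x \<in> \<real>\<^sub>\<ge>\<^sub>0)"

definition A_inner :: "('a::complex_hilbert \<Rightarrow> 'a) \<Rightarrow> 'a \<Rightarrow> 'a \<Rightarrow> complex"
  where "A_inner A x y = cinner (A x) y"

definition A_norm :: "('a::complex_hilbert \<Rightarrow> 'a) \<Rightarrow> 'a \<Rightarrow> real"
  where "A_norm A x = sqrt (Re (A_inner A x x))"

definition A_adjointable :: "('a::complex_hilbert \<Rightarrow> 'a) \<Rightarrow> ('a \<Rightarrow> 'a) set"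
  where "A_adjointable A =
    {T. bounded_clinear T \<and> (\<exists>R. bounded_clinear R \<and> A \<circ> R = cadjoint T \<circ> A)}"

text \<open>
  The two suprema below are over sets of nonnegative reals, so inserting \<open>0\<close> matters only
  when the set is empty, that is, for \<open>A = 0\<close>; it fixes the convention that the supremum is
  then \<open>0\<close> (the real-valued supremum of the empty set is unspecified).
\<close>

definition A_opnorm :: "('a::complex_hilbert \<Rightarrow> 'a) \<Rightarrow> ('a \<Rightarrow> 'a) \<Rightarrow> real"
  where "A_opnorm A T =
    Sup (insert 0 {A_norm A (T x) / A_norm A x | x. x \<in> closure (range A) \<and> x \<noteq> 0})"

definition A_numradius :: "('a::complex_hilbert \<Rightarrow> 'a) \<Rightarrow> ('a \<Rightarrow> 'a) \<Rightarrow> real"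
  where "A_numradius A T =
    Sup (insert 0 {cmod (A_inner A (T x) x) | x. A_norm A x = 1})"

definition block_op ::
  "('a::complex_hilbert \<Rightarrow> 'a) \<Rightarrow> ('a \<Rightarrow> 'a) \<Rightarrow> ('a \<Rightarrow> 'a) \<Rightarrow> ('a \<Rightarrow> 'a) \<Rightarrow> 'a \<times> 'a \<Rightarrow> 'a \<times> 'a"
  where "block_op T11 T12 T21 T22 = (\<lambda>(x, y). (T11 x + T12 y, T21 x + T22 y))"

end

theory Submission imports Defs
begin

text \<open>
  Let \<open>z = (x, y)\<close> with \<open>a = \<parallel>x\<parallel>\<^sub>A\<close>, \<open>b = \<parallel>y\<parallel>\<^sub>A\<close> and \<open>a\<^sup>2 + b\<^sup>2 = 1\<close>. The form
  of the block operator at \<open>z\<close> is at most \<open>w\<^sub>1 a\<^sup>2 + w\<^sub>2 b\<^sup>2 + (n\<^sub>1\<^sub>2 + n\<^sub>2\<^sub>1) a b\<close>, where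
  \<open>w\<^sub>i\<close> is the numerical radius of the \<open>i\<close>-th diagonal entry and \<open>n\<^sub>i\<^sub>j\<close> are the seminorms
  of the off-diagonal entries. Splitting \<open>w\<^sub>2\<close> as \<open>t w\<^sub>2 + (1 - t) w\<^sub>2\<close> leaves two binary
  quadratic forms, each bounded by its largest eigenvalue.

  That both suprema are finite rests on Reid's inequality, applied to \<open>R T\<close> for an
  \<open>A\<close>-adjoint \<open>R\<close> of \<open>T\<close>. The seminorm of \<open>T\<close> sees only the closure of the range of \<open>A\<close>;
  its orthogonal complement is the kernel of \<open>A\<close>, which \<open>T\<close> maps into itself.
\<close>

section \<open>Riesz representation, closures of subspaces, growth of powers\<close>

text \<open>The functional \<open>J\<close> is minimised over \<open>S\<close>: the parallelogram
  law makes a minimising sequence Cauchy, and the vanishing first variation of \<open>J\<close> at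
  its limit is the representation of \<open>f\<close>. With \<open>S = UNIV\<close> this yields
  adjoints, with \<open>f = inner x\<close> the orthogonal projection of \<open>x\<close> onto
  \<open>S\<close>.\<close>

lemma riesz_closed_subspace:
  fixes f :: "'a::{real_inner, complete_space} \<Rightarrow> real"
  assumes S: "subspace S" "closed S" and f: "bounded_linear f"
  obtains z where "z \<in> S" "\<And>s. s \<in> S \<Longrightarrow> f s = inner z s"
proof -
  interpret f: bounded_linear f by (fact f)
  obtain K where K: "\<And>x. norm (f x) \<le> norm x * K"
    using f.bounded by blast
  define J where "J x = (norm x)\<^sup>2 - 2 * f x" for x
  define d where "d = (INF x\<in>S. J x)"
  have J_lower: "- K\<^sup>2 \<le> J x" for x
  proof -
    have "f x \<le> norm x * K" using K[of x] by simp
    moreover have "0 \<le> (norm x - K)\<^sup>2" by simp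
    ultimately show ?thesis unfolding J_def by (simp add: power2_diff)
  qed
  have d_le: "d \<le> J x" if "x \<in> S" for x
    unfolding d_def by (rule cINF_lower) (use that J_lower in \<open>auto intro!: bdd_belowI2\<close>)
  have "\<exists>x\<in>S. J x < d + 1 / real (Suc n)" for n
  proof (rule ccontr)
    assume "\<not> ?thesis"
    then have "d + 1 / real (Suc n) \<le> d"
      unfolding d_def using subspace_0[OF S(1)] by (intro cINF_greatest) (auto simp: not_less)
    then show False by simp
  qed
  then obtain u where u: "\<And>n. u n \<in> S" "\<And>n. J (u n) < d + 1 / real (Suc n)"
    by metis
  have parallelogram: "(norm (x - y))\<^sup>2 \<le> 2 * (J x - d) + 2 * (J y - d)" if "x \<in> S" "y \<in> S" for x y
  proof -
    have "d \<le> J ((1/2) *\<^sub>R (x + y))"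
      using that S(1) by (intro d_le) (simp add: subspace_add subspace_scale)
    also have "\<dots> = (norm (x + y))\<^sup>2 / 4 - f x - f y"
      by (simp add: J_def f.scaleR f.add power_divide) (simp add: field_simps)
    finally show ?thesis
      unfolding J_def power2_norm_eq_inner by (simp add: inner_simps inner_commute field_simps)
  qed
  have "Cauchy u"
  proof (rule CauchyI)
    fix e :: real assume e: "0 < e"
    obtain N where N: "4 / e\<^sup>2 < real (Suc N)"
      using reals_Archimedean2 less_trans of_nat_less_iff lessI by metis
    have gap: "2 * (J (u n) - d) < e\<^sup>2 / 2" if "N \<le> n" for n
    proof -
      have "1 / real (Suc n) \<le> 1 / real (Suc N)"
        using that by (simp add: frac_le)
      also have "\<dots> < e\<^sup>2 / 4"
        using N e by (simp add: field_simps)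
      finally show ?thesis using u(2)[of n] by simp
    qed
    have "norm (u m - u n) < e" if "N \<le> m" "N \<le> n" for m n
    proof -
      have "(norm (u m - u n))\<^sup>2 < e\<^sup>2"
        using parallelogram[OF u(1)[of m] u(1)[of n]] gap[OF that(1)] gap[OF that(2)] by linarith
      then show ?thesis
        using e by (simp add: power_less_imp_less_base)
    qed
    then show "\<exists>M. \<forall>m\<ge>M. \<forall>n\<ge>M. norm (u m - u n) < e" by blast
  qed
  then obtain z where z: "u \<longlonglongrightarrow> z"
    using Cauchy_convergent_iff convergent_def by blast
  have zS: "z \<in> S"
    using closed_sequentially[OF S(2)] u(1) z by blast
  have lim_J: "(\<lambda>n. J (u n)) \<longlonglongrightarrow> J z"
    unfolding J_def by (intro tendsto_intros f.tendsto z)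
  have "(\<lambda>n. d + 1 / real (Suc n)) \<longlonglongrightarrow> d + 0"
    using LIMSEQ_inverse_real_of_nat by (intro tendsto_intros) (simp add: inverse_eq_divide)
  from LIMSEQ_le[OF lim_J this] have J_z: "J z \<le> d"
    using u(2) by (auto intro: less_imp_le)
  have "f s = inner z s" if s: "s \<in> S" for s
  proof -
    define g where "g = inner z s - f s"
    have *: "0 \<le> 2 * l * g + l\<^sup>2 * (norm s)\<^sup>2" for l
    proof -
      have "J z \<le> J (z + l *\<^sub>R s)"
        using J_z d_le[of "z + l *\<^sub>R s"] zS s S(1) by (simp add: subspace_add subspace_scale)
      also have "\<dots> = J z + 2 * l * g + l\<^sup>2 * (norm s)\<^sup>2"
        unfolding J_def g_def power2_norm_eq_inner
        by (simp add: f.add f.scaleR inner_simps inner_commute algebra_simps power2_eq_square)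
      finally show ?thesis by simp
    qed
    \<comment> \<open>Adding 1 keeps \<open>c\<close> positive even for \<open>s = 0\<close>. The
      value \<open>l = - g / c\<close> used next minimises \<open>2 * l * g + l\<^sup>2 * c\<close>,
      which dominates the quadratic above.\<close>
    define c where "c = (norm s)\<^sup>2 + 1"
    have c: "c > 0" by (simp add: c_def add_nonneg_pos)
    have "0 \<le> 2 * (- g / c) * g + (- g / c)\<^sup>2 * c"
      using *[of "- g / c"] mult_left_mono[of "(norm s)\<^sup>2" c "(- g / c)\<^sup>2"]
      by (simp add: c_def del: power_divide power_minus)
    also have "\<dots> = - (g\<^sup>2 / c)"
      using c by (simp add: power2_eq_square field_simps)
    finally have "g\<^sup>2 \<le> 0"
      using c by (simp add: divide_le_0_iff)
    then show ?thesis by (simp add: g_def)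
  qed
  with zS show thesis by (rule that)
qed

lemma subspace_closure:
  fixes S :: "'a::real_normed_vector set"
  assumes S: "subspace S"
  shows "subspace (closure S)"
proof (rule subspaceI)
  show "0 \<in> closure S"
    using subspace_0[OF S] closure_subset by blast
next
  fix x y assume "x \<in> closure S" "y \<in> closure S"
  then obtain u v where "\<And>n. u n \<in> S" "\<And>n. v n \<in> S" "u \<longlonglongrightarrow> x" "v \<longlonglongrightarrow> y"
    by (auto simp: closure_sequential)
  then show "x + y \<in> closure S"
    unfolding closure_sequential using subspace_add[OF S]
    by (intro exI[of _ "\<lambda>n. u n + v n"]) (auto intro: tendsto_add)
next
  fix c x assume "x \<in> closure S"
  then obtain u where "\<And>n. u n \<in> S" "u \<longlonglongrightarrow> x"
    by (auto simp: closure_sequential)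
  then show "c *\<^sub>R x \<in> closure S"
    unfolding closure_sequential using subspace_scale[OF S]
    by (intro exI[of _ "\<lambda>n. c *\<^sub>R u n"]) (auto intro: tendsto_intros)
qed

text \<open>Serves to shed constants from estimates along the exponents \<open>2 ^ n\<close>. If
  \<open>1 < q\<close>, already \<open>q ^ n\<close>, which is at most \<open>q ^ (2 ^ n)\<close>,
  is unbounded.\<close>

lemma le_one_if_powers_bounded:
  fixes q K :: real
  assumes "\<And>n. q ^ (2 ^ n) \<le> K"
  shows "q \<le> 1"
proof (rule ccontr)
  assume "\<not> q \<le> 1"
  then have q: "1 < q" by simp
  obtain n where "K < q ^ n" using real_arch_pow[OF q] by blast
  also have "\<dots> \<le> q ^ (2 ^ n)"
    using q less_exp[of n] by (intro power_increasing) (auto intro: less_imp_le)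
  finally show False using assms[of n] by simp
qed

section \<open>Complex inner products and the adjoint\<close>

lemma bounded_clinearD:
  assumes "bounded_clinear T"
  shows "bounded_linear T" and "T (c *\<^sub>C x) = c *\<^sub>C T x"
  using assms by (simp_all add: bounded_clinear_def)

lemma cinner_add_right: "cinner x (y + z) = cinner x y + cinner x z"
  using cinner_commute[of x] cinner_commute[of y x] cinner_commute[of z x] cinner_add_left[of y z x]
  by (metis complex_cnj_add)

lemma cinner_scaleC_right: "cinner x (c *\<^sub>C y) = cnj c * cinner x y"
  by (metis cinner_commute cinner_scaleC_left complex_cnj_mult)

lemma Im_cinner: "Im (cinner x y) = - inner (\<i> *\<^sub>C x) y"
  unfolding Re_cinner[symmetric] by (simp add: cinner_scaleC_left)

text \<open>Justifies the definite description in \<open>cadjoint\<close>: Riesz on the whole space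
  provides a real adjoint, complex linearity of \<open>T\<close> lifts it to the sesquilinear form,
  and nondegeneracy gives uniqueness.\<close>

lemma cadjoint_inner:
  assumes T: "bounded_clinear T"
  shows "inner (T x) y = inner x (cadjoint T y)"
proof -
  interpret T: bounded_linear T by (rule bounded_clinearD[OF T])
  have "\<exists>z. \<forall>x. inner (T x) y = inner x z" for y
  proof -
    have "bounded_linear (\<lambda>x. inner (T x) y)"
      by (rule bounded_linear_compose[OF bounded_linear_inner_left T.bounded_linear_axioms])
    then obtain z where "\<And>x. inner (T x) y = inner z x"
      using riesz_closed_subspace[of UNIV "\<lambda>x. inner (T x) y"] by auto
    then show ?thesis by (auto simp: inner_commute)
  qed
  then obtain S where S: "\<And>x y. inner (T x) y = inner x (S y)"
    by metis
  have "\<forall>x y. cinner (T x) y = cinner x (S y)"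
    by (simp add: complex_eq_iff Re_cinner Im_cinner bounded_clinearD(2)[OF T, symmetric] S)
  moreover have "S' = S" if "\<forall>x y. cinner (T x) y = cinner x (S' y)" for S'
  proof
    fix y
    have "inner x (S' y - S y) = 0" for x
      using that S by (metis Re_cinner inner_diff_right diff_self)
    from this[of "S' y - S y"] show "S' y = S y" by simp
  qed
  ultimately have "cadjoint T = S"
    unfolding cadjoint_def by (rule the_equality)
  with S show ?thesis by simp
qed

section \<open>The semi-inner product of a positive operator\<close>

context
  fixes A :: "'a::complex_hilbert \<Rightarrow> 'a"
  assumes A: "positive_op A"
begin

lemma A_clinear: "bounded_clinear A"
  using A by (simp add: positive_op_def)

interpretation A: bounded_linear A
  by (rule bounded_clinearD[OF A_clinear])

lemma A_form_real: "cinner (A x) x = complex_of_real (inner (A x) x)"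
  using A complex_nonneg_Reals_iff by (auto simp: positive_op_def complex_eq_iff Re_cinner)

lemma A_form_nonneg: "0 \<le> inner (A x) x"
  using A complex_nonneg_Reals_iff by (auto simp: positive_op_def simp flip: Re_cinner)

lemma A_norm_sq: "(A_norm A x)\<^sup>2 = inner (A x) x"
  by (simp add: A_norm_def A_inner_def Re_cinner A_form_nonneg)

lemma A_norm_nonneg [simp]: "0 \<le> A_norm A x"
  by (simp add: A_norm_def A_inner_def Re_cinner A_form_nonneg)

text \<open>Polarisation: the form at \<open>\<i> *\<^sub>C x + y\<close> is real, and the imaginary
  part of its cross terms is the difference of the two sides.\<close>

lemma A_symmetric: "inner (A x) y = inner (A y) x"
proof -
  define z where "z = \<i> *\<^sub>C x + y"
  have Im: "Im (cinner (A u) u) = 0" for u by (simp add: A_form_real)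
  show ?thesis
    using Im[of z] Im[of x] Im[of y] unfolding z_def
    by (simp add: A.add bounded_clinearD[OF A_clinear] cinner_add_left cinner_add_right
        cinner_scaleC_left cinner_scaleC_right flip: Re_cinner)
qed

lemma A_Cauchy_Schwarz_real: "\<bar>inner (A x) y\<bar> \<le> A_norm A x * A_norm A y"
proof -
  define a b c where "a = inner (A x) x" and "b = inner (A x) y" and "c = inner (A y) y"
  have quad: "0 \<le> l\<^sup>2 * a + 2 * l * m * b + m\<^sup>2 * c" for l m
    using A_form_nonneg[of "l *\<^sub>R x + m *\<^sub>R y"] A_symmetric[of y x]
    by (simp add: a_def b_def c_def A.add A.scaleR inner_simps power2_eq_square algebra_simps)
  have "b\<^sup>2 \<le> a * c"
  proof (cases "c = 0")
    case True
    have "b = 0"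
    proof (rule ccontr)
      assume "b \<noteq> 0"
      \<comment> \<open>For \<open>c = 0\<close> and \<open>l = 1\<close> the form is affine in
        \<open>m\<close>; this \<open>m\<close> gives it the value -1.\<close>
      with quad[of 1 "- (a + 1) / (2 * b)"] True show False by (simp add: field_simps)
    qed
    with True show ?thesis by simp
  next
    case False
    then have "c > 0" using A_form_nonneg[of y] by (simp add: c_def)
    have "0 \<le> c * (a * c - b\<^sup>2)"
      using quad[of c "- b"] by (simp add: power2_eq_square algebra_simps)
    with \<open>c > 0\<close> show ?thesis by (simp add: zero_le_mult_iff)
  qed
  also have "\<dots> = (A_norm A x * A_norm A y)\<^sup>2"
    by (simp add: power_mult_distrib A_norm_sq a_def c_def)
  finally show ?thesis
    unfolding b_def by (simp add: abs_mult flip: abs_le_square_iff)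
qed

lemma A_norm_scaleC: "A_norm A (c *\<^sub>C x) = cmod c * A_norm A x"
proof (rule power2_eq_imp_eq)
  have "(A_norm A (c *\<^sub>C x))\<^sup>2 = Re (c * cnj c * cinner (A x) x)"
    unfolding A_norm_sq
    by (simp add: bounded_clinearD[OF A_clinear] cinner_scaleC_left cinner_scaleC_right mult_ac
        flip: Re_cinner)
  also have "\<dots> = (cmod c * A_norm A x)\<^sup>2"
    by (simp add: A_form_real A_norm_sq power_mult_distrib flip: complex_norm_square)
  finally show "(A_norm A (c *\<^sub>C x))\<^sup>2 = (cmod c * A_norm A x)\<^sup>2" .
qed simp_all

lemma A_Cauchy_Schwarz: "cmod (cinner (A x) y) \<le> A_norm A x * A_norm A y"
proof (cases "cinner (A x) y = 0")
  case False
  \<comment> \<open>A unimodular factor turns the complex value into its modulus and leaves the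
    seminorm of \<open>x\<close> unchanged, so the real inequality applies.\<close>
  define c where "c = cnj (sgn (cinner (A x) y))"
  have "c * cinner (A x) y = cinner (A x) y * cnj (cinner (A x) y) / cmod (cinner (A x) y)"
    by (simp add: c_def sgn_eq)
  also have "\<dots> = cmod (cinner (A x) y)"
    using False by (simp add: power2_eq_square flip: complex_norm_square)
  finally have "cmod (cinner (A x) y) = Re (c * cinner (A x) y)" by simp
  also have "\<dots> = inner (A (c *\<^sub>C x)) y"
    by (simp add: bounded_clinearD[OF A_clinear] cinner_scaleC_left flip: Re_cinner)
  also have "\<dots> \<le> A_norm A (c *\<^sub>C x) * A_norm A y"
    using A_Cauchy_Schwarz_real abs_le_D1 by blast
  also have "\<dots> = A_norm A x * A_norm A y"
    using False by (simp add: A_norm_scaleC c_def norm_sgn)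
  finally show ?thesis .
qed simp

lemma A_norm_add_null:
  assumes "A k = 0"
  shows "A_norm A (x + k) = A_norm A x"
  using assms A_symmetric[of x k] by (simp add: A_norm_def A_inner_def Re_cinner A.add inner_simps)

section \<open>Reid's inequality and boundedness in the seminorm\<close>

text \<open>Reid's inequality, obtained by iterating the Cauchy-Schwarz inequality along the powers
  \<open>P ^ (2 ^ n)\<close>.\<close>

lemma A_form_selfadjoint_le:
  assumes P: "bounded_linear P" and sym: "\<And>x y. inner (A (P x)) y = inner (A x) (P y)"
  shows "\<exists>K\<ge>0. \<forall>x. inner (A (P x)) x \<le> K * inner (A x) x"
proof -
  interpret P: bounded_linear P by (fact P)
  obtain K where K: "K > 0" "\<And>x. norm (P x) \<le> norm x * K"
    using P.pos_bounded by blast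
  obtain L where L: "L > 0" "\<And>x. norm (A x) \<le> norm x * L"
    using A.pos_bounded by blast
  have pow: "norm ((P ^^ n) x) \<le> norm x * K ^ n" for n x
  proof (induction n)
    case (Suc n)
    have "norm ((P ^^ Suc n) x) \<le> norm ((P ^^ n) x) * K" using K(2) by simp
    also have "\<dots> \<le> norm x * K ^ n * K" using Suc K(1) by (intro mult_right_mono) auto
    finally show ?case by (simp add: mult_ac)
  qed simp
  have sym_pow: "inner (A ((P ^^ n) x)) y = inner (A x) ((P ^^ n) y)" for n x y
    by (induction n arbitrary: y) (simp_all add: sym, simp add: funpow_swap1)
  have "inner (A (P x)) x \<le> K * inner (A x) x" for x
  proof -
    define c where "c n = inner (A ((P ^^ n) x)) x" for n
    \<comment> \<open>Cauchy-Schwarz for \<open>(P ^^ m) x\<close> and \<open>x\<close>; symmetry of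
      \<open>P\<close> in the form turns the squared seminorm of the former into
      \<open>c (2 * m)\<close>.\<close>
    have sq: "(c m)\<^sup>2 \<le> c 0 * c (2 * m)" for m
    proof -
      have "\<bar>c m\<bar>\<^sup>2 \<le> (A_norm A ((P ^^ m) x) * A_norm A x)\<^sup>2"
        unfolding c_def by (intro power_mono A_Cauchy_Schwarz_real) simp
      also have "\<dots> = c (2 * m) * c 0"
        by (simp add: power_mult_distrib A_norm_sq c_def mult_2 funpow_add sym_pow)
      finally show ?thesis by (simp add: mult.commute)
    qed
    have c0: "0 \<le> c 0" by (simp add: c_def A_form_nonneg)
    \<comment> \<open>This is \<open>c 1 ^ (2 ^ n) \<le> c 0 ^ (2 ^ n - 1) * c (2 ^ n)\<close>
      multiplied by \<open>c 0\<close>, which avoids the subtracted exponent. The induction step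
      squares the inequality and applies \<open>sq\<close>.\<close>
    have ceven: "c 1 ^ (2 ^ n) * c 0 \<le> c 0 ^ (2 ^ n) * c (2 ^ n)" if "0 \<le> c 1" for n
    proof (induction n)
      case (Suc n)
      have "c 0 * (c 1 ^ (2 ^ Suc n) * c 0) = (c 1 ^ (2 ^ n) * c 0)\<^sup>2"
        by (simp add: power_mult_distrib power2_eq_square mult_2 power_add)
      also have "\<dots> \<le> (c 0 ^ (2 ^ n) * c (2 ^ n))\<^sup>2"
        using Suc that c0 by (intro power_mono) simp_all
      also have "\<dots> \<le> (c 0 ^ (2 ^ n))\<^sup>2 * (c 0 * c (2 * 2 ^ n))"
        using sq[of "2 ^ n"] by (simp add: power_mult_distrib mult_left_mono)
      also have "\<dots> = c 0 * (c 0 ^ (2 ^ Suc n) * c (2 ^ Suc n))"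
        by (simp add: power2_eq_square mult_2 power_add)
      finally show ?case
        using c0 by (cases "c 0 = 0") (auto simp: mult_le_cancel_left power_0_left)
    qed simp
    have "c 1 \<le> K * c 0"
    proof (cases "c 0 = 0 \<or> c 1 < 0")
      case True
      have "c 1 \<le> 0" using True sq[of 1] by auto
      then show ?thesis using K(1) c0 by (meson mult_nonneg_nonneg less_imp_le order_trans)
    next
      case False
      then have pos: "0 < c 0" "0 \<le> c 1" using c0 by auto
      \<comment> \<open>The norm of \<open>(P ^^ (2 ^ n)) x\<close> grows at most like
        \<open>K ^ (2 ^ n)\<close>, so dividing by \<open>c 0 * K\<close> leaves a bound independent
        of \<open>n\<close>.\<close>
      have "(c 1 / (c 0 * K)) ^ (2 ^ n) \<le> L * (norm x)\<^sup>2 / c 0" for n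
      proof -
        have "c (2 ^ n) \<le> norm (A ((P ^^ (2 ^ n)) x)) * norm x"
          unfolding c_def by (rule norm_cauchy_schwarz)
        also have "\<dots> \<le> norm x * K ^ (2 ^ n) * L * norm x"
          using L pow[of "2 ^ n" x]
          by (intro mult_right_mono order_trans[OF L(2)]) auto
        finally have "c 1 ^ (2 ^ n) * c 0 \<le> c 0 ^ (2 ^ n) * (norm x * K ^ (2 ^ n) * L * norm x)"
          using ceven[OF pos(2), of n] pos(1)
          by (meson mult_left_mono order_trans zero_le_power less_imp_le)
        then show ?thesis
          using pos(1) K(1)
          by (simp add: power_divide power_mult_distrib field_simps power2_eq_square)
      qed
      then have "c 1 / (c 0 * K) \<le> 1" by (rule le_one_if_powers_bounded)
      then show ?thesis using pos(1) K(1) by (simp add: field_simps)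
    qed
    then show ?thesis by (simp add: c_def)
  qed
  with K(1) show ?thesis by (intro exI[of _ K]) auto
qed

text \<open>The squared seminorm of \<open>T x\<close> is the form of \<open>R (T x)\<close> against
  \<open>x\<close>, and \<open>R\<close> after \<open>T\<close> is symmetric for the form of
  \<open>A\<close>. Reid's inequality supplies \<open>K\<close>, and \<open>sqrt K\<close> is the
  bound.\<close>

lemma A_adjointable_bounded:
  assumes T: "T \<in> A_adjointable A"
  obtains C where "C \<ge> 0" "\<And>x. A_norm A (T x) \<le> C * A_norm A x"
proof -
  obtain R where T': "bounded_clinear T" and R: "bounded_clinear R" "A \<circ> R = cadjoint T \<circ> A"
    using T by (auto simp: A_adjointable_def)
  have adj: "inner (A (T x)) y = inner (A x) (R y)" for x y
  proof -
    have "inner (A (T x)) y = inner (T x) (A y)"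
      by (metis A_symmetric inner_commute)
    also have "\<dots> = inner x (A (R y))"
      using cadjoint_inner[OF T'] fun_cong[OF R(2), of y] by simp
    also have "\<dots> = inner (A x) (R y)"
      by (metis A_symmetric inner_commute)
    finally show ?thesis .
  qed
  have "bounded_linear (\<lambda>x. R (T x))"
    by (rule bounded_linear_compose) (rule bounded_clinearD[OF T'] bounded_clinearD[OF R(1)])+
  moreover have "inner (A (R (T x))) y = inner (A x) (R (T y))" for x y
  proof -
    have "inner (A (R (T x))) y = inner (A y) (R (T x))" by (rule A_symmetric)
    also have "\<dots> = inner (A (T y)) (T x)" by (simp add: adj)
    also have "\<dots> = inner (A (T x)) (T y)" by (rule A_symmetric)
    finally show ?thesis by (simp add: adj)
  qed
  ultimately obtain K where K: "K \<ge> 0" "\<And>x. inner (A (R (T x))) x \<le> K * inner (A x) x"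
    using A_form_selfadjoint_le by blast
  have "A_norm A (T x) \<le> sqrt K * A_norm A x" for x
  proof (rule power2_le_imp_le)
    have "(A_norm A (T x))\<^sup>2 = inner (A (R (T x))) x"
      using A_symmetric[of x "R (T x)"] by (simp add: A_norm_sq adj)
    also have "\<dots> \<le> (sqrt K * A_norm A x)\<^sup>2"
      using K by (simp add: power_mult_distrib A_norm_sq)
    finally show "(A_norm A (T x))\<^sup>2 \<le> (sqrt K * A_norm A x)\<^sup>2" .
  qed (use K in simp)
  with K(1) show thesis by (intro that[of "sqrt K"]) auto
qed

section \<open>Bounds by the numerical radius and the operator seminorm\<close>

text \<open>Cauchy-Schwarz and the bound on \<open>T\<close> make the supremum finite. A vector of
  positive seminorm is scaled to seminorm 1; at one of seminorm 0 the form vanishes.\<close>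

lemma A_numradius:
  assumes T: "T \<in> A_adjointable A"
  shows A_numradius_nonneg: "0 \<le> A_numradius A T"
    and A_numradius_bound: "cmod (cinner (A (T x)) x) \<le> A_numradius A T * (A_norm A x)\<^sup>2"
proof -
  obtain C where C: "C \<ge> 0" "\<And>x. A_norm A (T x) \<le> C * A_norm A x"
    using A_adjointable_bounded[OF T] by blast
  define W where "W = insert 0 {cmod (A_inner A (T x) x) | x. A_norm A x = 1}"
  have form_le: "cmod (cinner (A (T x)) x) \<le> C * (A_norm A x)\<^sup>2" for x
  proof -
    have "cmod (cinner (A (T x)) x) \<le> A_norm A (T x) * A_norm A x" by (rule A_Cauchy_Schwarz)
    also have "\<dots> \<le> C * A_norm A x * A_norm A x" using C by (intro mult_right_mono) auto
    finally show ?thesis by (simp add: power2_eq_square)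
  qed
  have bdd: "bdd_above W"
  proof (rule bdd_aboveI[of _ C])
    fix w assume "w \<in> W"
    moreover have "cmod (cinner (A (T x)) x) \<le> C" if "A_norm A x = 1" for x
      using form_le[of x] that by simp
    ultimately show "w \<le> C" using C(1) by (auto simp: W_def A_inner_def)
  qed
  have upper: "w \<le> A_numradius A T" if "w \<in> W" for w
    using cSup_upper[OF that bdd] by (simp add: A_numradius_def W_def)
  show "0 \<le> A_numradius A T" by (rule upper) (simp add: W_def)
  show "cmod (cinner (A (T x)) x) \<le> A_numradius A T * (A_norm A x)\<^sup>2"
  proof (cases "A_norm A x = 0")
    case True
    then show ?thesis using form_le[of x] by simp
  next
    case False
    define c where "c = complex_of_real (1 / A_norm A x)"
    have c: "cmod c = 1 / A_norm A x" by (simp add: c_def norm_divide)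
    have "A_norm A (c *\<^sub>C x) = 1" using False by (simp add: A_norm_scaleC c)
    then have "cmod (cinner (A (T (c *\<^sub>C x))) (c *\<^sub>C x)) \<le> A_numradius A T"
      by (intro upper) (auto simp: W_def A_inner_def)
    moreover have "T (c *\<^sub>C x) = c *\<^sub>C T x"
      using T by (auto simp: A_adjointable_def dest: bounded_clinearD)
    ultimately have "cmod c * (cmod c * cmod (cinner (A (T x)) x)) \<le> A_numradius A T"
      by (simp add: bounded_clinearD[OF A_clinear] cinner_scaleC_left cinner_scaleC_right norm_mult)
    moreover have "0 < A_norm A x" using False A_norm_nonneg[of x] by linarith
    ultimately show ?thesis by (simp add: c field_simps power2_eq_square)
  qed
qed

text \<open>Here \<open>p\<close> is the orthogonal projection of \<open>x\<close>. The remainder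
  \<open>k\<close> is orthogonal to the range of \<open>A\<close>, in particular to
  \<open>A (A k)\<close>, and by symmetry that inner product is the squared norm of
  \<open>A k\<close>.\<close>

lemma closure_range_decomposition:
  obtains p k where "x = p + k" "p \<in> closure (range A)" "A k = 0"
proof -
  have "subspace (closure (range A))"
    by (intro subspace_closure subspace_UNIV linear_subspace_image) (rule A.linear_axioms)
  then obtain p where p: "p \<in> closure (range A)"
    "\<And>s. s \<in> closure (range A) \<Longrightarrow> inner x s = inner p s"
    using riesz_closed_subspace[of "closure (range A)" "inner x"]
    by (auto simp: bounded_linear_inner_right)
  define k where "k = x - p"
  have "inner (A y) k = 0" for y
    using p(2)[of "A y"] closure_subset[of "range A"] by (auto simp: k_def inner_simps inner_commute)
  then have "inner (A k) (A k) = 0"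
    using A_symmetric by metis
  then show thesis using p(1) by (intro that[of p k]) (auto simp: k_def)
qed

text \<open>The supremum controls the component \<open>p\<close> of \<open>x\<close> in the closure
  of the range; adding the component \<open>k\<close> from the kernel alters neither of the two
  seminorms.\<close>

lemma A_opnorm_bound:
  assumes T: "T \<in> A_adjointable A"
  shows "A_norm A (T x) \<le> A_opnorm A T * A_norm A x"
proof -
  obtain C where C: "C \<ge> 0" "\<And>x. A_norm A (T x) \<le> C * A_norm A x"
    using A_adjointable_bounded[OF T] by blast
  define W where
    "W = insert 0 {A_norm A (T x) / A_norm A x | x. x \<in> closure (range A) \<and> x \<noteq> 0}"
  have bdd: "bdd_above W"
  proof (rule bdd_aboveI[of _ C])
    fix w assume "w \<in> W"
    \<comment> \<open>A zero denominator makes the quotient 0 by convention, which \<open>C\<close>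
      also dominates.\<close>
    moreover have "A_norm A (T x) / A_norm A x \<le> C" for x
      using C A_norm_nonneg[of x] by (cases "A_norm A x = 0") (auto simp: divide_le_eq less_le)
    ultimately show "w \<le> C" using C(1) by (auto simp: W_def)
  qed
  have upper: "w \<le> A_opnorm A T" if "w \<in> W" for w
    using cSup_upper[OF that bdd] by (simp add: A_opnorm_def W_def)
  obtain p k where x: "x = p + k" and p: "p \<in> closure (range A)" and k: "A k = 0"
    by (rule closure_range_decomposition)
  have "A_norm A (T k) = 0"
    using C(2)[of k] A_norm_nonneg[of "T k"] k by (simp add: A_norm_def[of A k] A_inner_def Re_cinner)
  \<comment> \<open>Cauchy-Schwarz against \<open>A (T k)\<close> itself places \<open>T k\<close>,
    whose seminorm is 0, in the kernel of \<open>A\<close>.\<close>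
  then have "norm (A (T k)) ^ 2 \<le> 0"
    using A_Cauchy_Schwarz_real[of "T k" "A (T k)"] by (simp add: power2_norm_eq_inner)
  then have Tk: "A (T k) = 0" by simp
  have "A_norm A (T p) \<le> A_opnorm A T * A_norm A p"
  proof (cases "A_norm A p = 0")
    case True
    then show ?thesis using C(2)[of p] by simp
  next
    case False
    then have "p \<noteq> 0" by (auto simp: A_norm_def A_inner_def Re_cinner A.zero)
    then have "A_norm A (T p) / A_norm A p \<le> A_opnorm A T"
      using p by (intro upper) (auto simp: W_def)
    then show ?thesis using False A_norm_nonneg[of p] by (simp add: field_simps)
  qed
  moreover have "T x = T p + T k"
    using T x by (auto simp: A_adjointable_def bounded_clinear_def bounded_linear.linear linear_add)
  ultimately show ?thesis by (simp add: x A_norm_add_null k Tk)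
qed

lemma A_opnorm_form_bound:
  assumes T: "T \<in> A_adjointable A"
  shows "cmod (cinner (A (T x)) y) \<le> A_opnorm A T * (A_norm A x * A_norm A y)"
proof -
  have "cmod (cinner (A (T x)) y) \<le> A_norm A (T x) * A_norm A y" by (rule A_Cauchy_Schwarz)
  also have "\<dots> \<le> A_opnorm A T * A_norm A x * A_norm A y"
    by (intro mult_right_mono A_opnorm_bound T) simp
  finally show ?thesis by (simp add: mult.assoc)
qed

end

section \<open>Binary quadratic forms and the block estimate\<close>

text \<open>The right-hand side is the largest eigenvalue of the form \<open>c b\<^sup>2 + n a b\<close>.\<close>

lemma quadratic_form_le:
  fixes a b c n :: real
  assumes ab: "a\<^sup>2 + b\<^sup>2 = 1"
  shows "c * b\<^sup>2 + n * (a * b) \<le> (1/2) * c + (1/2) * sqrt (c\<^sup>2 + n\<^sup>2)"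
proof -
  \<comment> \<open>Double-angle coordinates: \<open>b\<^sup>2 - a\<^sup>2\<close> and
    \<open>2 * (a * b)\<close> are the entries of a unit vector because \<open>a\<close> and
    \<open>b\<close> are.\<close>
  have "(b\<^sup>2 - a\<^sup>2)\<^sup>2 + (2 * (a * b))\<^sup>2 = (a\<^sup>2 + b\<^sup>2)\<^sup>2"
    by (simp add: power2_eq_square algebra_simps)
  then have "(b\<^sup>2 - a\<^sup>2)\<^sup>2 + (2 * (a * b))\<^sup>2 = 1" by (simp add: ab)
  \<comment> \<open>The two-square identity, that is, Cauchy-Schwarz in the plane with its defect
    term.\<close>
  moreover have "(c * (b\<^sup>2 - a\<^sup>2) + n * (2 * (a * b)))\<^sup>2
      + (c * (2 * (a * b)) - n * (b\<^sup>2 - a\<^sup>2))\<^sup>2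
      = (c\<^sup>2 + n\<^sup>2) * ((b\<^sup>2 - a\<^sup>2)\<^sup>2 + (2 * (a * b))\<^sup>2)"
    by (simp only: power2_eq_square) algebra
  ultimately have "(c * (b\<^sup>2 - a\<^sup>2) + n * (2 * (a * b)))\<^sup>2 \<le> c\<^sup>2 + n\<^sup>2"
    by (metis le_add_same_cancel1 mult.right_neutral zero_le_power2)
  then have *: "c * (b\<^sup>2 - a\<^sup>2) + n * (2 * (a * b)) \<le> sqrt (c\<^sup>2 + n\<^sup>2)"
    by (rule real_le_rsqrt)
  have "2 * (c * b\<^sup>2) = c * (b\<^sup>2 - a\<^sup>2) + c * (a\<^sup>2 + b\<^sup>2)"
    by (simp add: algebra_simps)
  with * show ?thesis by (simp add: ab)
qed

theorem theorem6:
  fixes A T11 T12 T21 T22 :: "'a::complex_hilbert \<Rightarrow> 'a"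
    and B :: "'a \<times> 'a \<Rightarrow> 'a \<times> 'a"
    and t :: real
  assumes nontrivial: "\<exists>x::'a. x \<noteq> 0"
    and A: "positive_op A"
    and T: "T11 \<in> A_adjointable A" "T12 \<in> A_adjointable A"
      "T21 \<in> A_adjointable A" "T22 \<in> A_adjointable A"
    and B: "B = block_op A (\<lambda>_. 0) (\<lambda>_. 0) A"
    and t: "0 \<le> t" "t \<le> 1"
  shows "A_numradius B (block_op T11 T12 T21 T22)
    \<le> (1/2) * A_numradius A T22 + A_numradius A T11
      + (1/2) * sqrt (t^2 * (A_numradius A T22)^2 + (A_opnorm A T21)^2)
      + (1/2) * sqrt ((1 - t)^2 * (A_numradius A T22)^2 + (A_opnorm A T12)^2)"
    (is "_ \<le> ?rhs")
proof -
  define w1 w2 n12 n21 where "w1 = A_numradius A T11" and "w2 = A_numradius A T22"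
    and "n12 = A_opnorm A T12" and "n21 = A_opnorm A T21"
  have w: "0 \<le> w1" "0 \<le> w2"
    using A_numradius_nonneg[OF A] T by (simp_all add: w1_def w2_def)
  interpret A: bounded_linear A
    by (rule bounded_clinearD[OF A_clinear[OF A]])
  have bound: "cmod (A_inner B (block_op T11 T12 T21 T22 z) z) \<le> ?rhs" if z: "A_norm B z = 1" for z
  proof -
    obtain x y where xy: "z = (x, y)" by (cases z)
    define a b where "a = A_norm A x" and "b = A_norm A y"
    have "a\<^sup>2 + b\<^sup>2 = inner (A x) x + inner (A y) y"
      by (simp add: a_def b_def A_norm_sq[OF A])
    also have "\<dots> = 1"
      using z by (simp add: A_norm_def A_inner_def B block_op_def xy cinner_prod_def Re_cinner)
    finally have ab: "a\<^sup>2 + b\<^sup>2 = 1" .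
    then have a_le: "a\<^sup>2 \<le> 1"
      using zero_le_power2[of b] by linarith
    have "cmod (A_inner B (block_op T11 T12 T21 T22 z) z)
        = cmod (cinner (A (T11 x)) x + cinner (A (T12 y)) x
          + cinner (A (T21 x)) y + cinner (A (T22 y)) y)"
      by (simp add: A_inner_def B block_op_def xy cinner_prod_def A.add cinner_add_left add_ac)
    also have "\<dots> \<le> cmod (cinner (A (T11 x)) x) + cmod (cinner (A (T12 y)) x)
          + cmod (cinner (A (T21 x)) y) + cmod (cinner (A (T22 y)) y)"
      by (intro norm_triangle_mono order_refl)
    also have "\<dots> \<le> w1 * a\<^sup>2 + n12 * (b * a) + n21 * (a * b) + w2 * b\<^sup>2"
      unfolding w1_def w2_def n12_def n21_def a_def b_def
      by (intro add_mono A_numradius_bound[OF A] A_opnorm_form_bound[OF A] T)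
    \<comment> \<open>Bounding \<open>a\<^sup>2\<close> by 1 detaches \<open>w1\<close>, so the
      remaining forms involve only \<open>b\<^sup>2\<close> and \<open>a * b\<close>. The weight
      \<open>t\<close> then goes with \<open>n21\<close> and \<open>1 - t\<close> with
      \<open>n12\<close>, as in the two square roots.\<close>
    also have "\<dots> \<le> w1 + n12 * (b * a) + n21 * (a * b) + w2 * b\<^sup>2"
      using mult_left_mono[OF a_le w(1)] by simp
    also have "\<dots> = w1 + (t * w2 * b\<^sup>2 + n21 * (a * b)) + ((1 - t) * w2 * b\<^sup>2 + n12 * (a * b))"
      by (simp add: algebra_simps)
    also have "\<dots> \<le> w1 + ((1/2) * (t * w2) + (1/2) * sqrt ((t * w2)\<^sup>2 + n21\<^sup>2))
        + ((1/2) * ((1 - t) * w2) + (1/2) * sqrt (((1 - t) * w2)\<^sup>2 + n12\<^sup>2))"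
      by (intro add_mono order_refl quadratic_form_le ab)
    also have "\<dots> = ?rhs"
      by (simp add: w1_def w2_def n12_def n21_def power_mult_distrib) (simp add: field_simps)
    finally show ?thesis .
  qed
  \<comment> \<open>Covers the element 0 inserted into the supremum that defines
    \<open>A_numradius\<close>.\<close>
  have "0 \<le> ?rhs"
    using w by (simp add: w1_def w2_def)
  with bound show ?thesis
    unfolding A_numradius_def[of B] by (intro cSup_least) auto
qed

end
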